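(* Let $h,p,k$ be positive integers with $1\le p\le h$ and $k\ge2$, and let $G$ be the graph on $n=h+(k-1)p$ vertices whose vertex set is the disjoint union of a set $C$ of $h-p$ vertices and $k$ sets $P_1,\dots,P_k$ of $p$ vertices each, such that $C\cup P_j$ is a clique for every $j$ and there are no edges between $P_i$ and $P_j$ for $i\ne j$ (so $G$ is a union of $k$ cliques of order $h$ having a common clique of order $h-p$). Let $S(G)=J_n-I_n-2A(G)$ be the Seidel adjacency matrix of $G$ (equivalently, the adjacency matrix of the signed complete graph on $n$ vertices whose negative edges are exactly the edges of $G$). Then the eigenvalues of $S(G)$ (with multiplicity) are the roots of the polynomial $$F(\lambda)=(1-2p-\lambda)^{\frac{n-h}{p}-1}(1-\lambda)^{n-2-\frac{n-h}{p}}\,s(\lambda),$$ where $$s(\lambda)=-\lambda^3-(2h-n+2p-3)\lambda^2-\big(2h^2-2(h-1)n+2(h-2)p-4h+3\big)\lambda+2h^2-(2h-1)n-2(2h^2-2hn-h+1)p-2h+4(h-n)p^2+1 .$$ In particular, $S(G)$ has eigenvalue $1$ with multiplicity at least $n-h-\frac{n-h}{p}$, and eigenvalue $1-2p$ with multiplicity at least $\frac{n-h}{p}-1$.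
   Context: $A(G)$ is the $0/1$ adjacency matrix of $G$, $J_n$ the $n\times n$ all-ones matrix and $I_n$ the identity matrix. Note $\frac{n-h}{p}=k-1$. *)

theory Defs
  imports "Jordan_Normal_Form.Char_Poly" Complex_Main
begin

definition simple_graph :: "'v set \<Rightarrow> 'v set set \<Rightarrow> bool" where
  "simple_graph V E \<longleftrightarrow> finite V \<and> (\<forall>e\<in>E. e \<subseteq> V \<and> card e = 2)"

definition is_clique :: "'v set set \<Rightarrow> 'v set \<Rightarrow> bool" where
  "is_clique E X \<longleftrightarrow> (\<forall>u\<in>X. \<forall>v\<in>X. u \<noteq> v \<longrightarrow> {u, v} \<in> E)"

text \<open>The rows and columns are indexed by the vertices in the order given by the list \<open>vs\<close>,
  which is meant to enumerate the vertex set without repetition.\<close>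

definition adjacency_matrix :: "'v list \<Rightarrow> 'v set set \<Rightarrow> 'a::comm_ring_1 mat" where
  "adjacency_matrix vs E =
     mat (length vs) (length vs) (\<lambda>(i, j). if {vs ! i, vs ! j} \<in> E then 1 else 0)"

definition all_ones_matrix :: "nat \<Rightarrow> 'a::comm_ring_1 mat" where
  "all_ones_matrix n = mat n n (\<lambda>_. 1)"

definition seidel_matrix :: "'v list \<Rightarrow> 'v set set \<Rightarrow> 'a::comm_ring_1 mat" where
  "seidel_matrix vs E =
     all_ones_matrix (length vs) - 1\<^sub>m (length vs) - 2 \<cdot>\<^sub>m adjacency_matrix vs E"

text \<open>The multiset of complex eigenvalues, each counted with its algebraic multiplicity.\<close>

definition eigenvalue_mset :: "complex mat \<Rightarrow> complex multiset" where
  "eigenvalue_mset A = proots (char_poly A)"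

definition cubic_factor :: "complex \<Rightarrow> complex \<Rightarrow> complex \<Rightarrow> complex \<Rightarrow> complex" where
  "cubic_factor h n p x =
     - (x ^ 3) - (2 * h - n + 2 * p - 3) * x ^ 2
     - (2 * h ^ 2 - 2 * (h - 1) * n + 2 * (h - 2) * p - 4 * h + 3) * x
     + 2 * h ^ 2 - (2 * h - 1) * n - 2 * (2 * h ^ 2 - 2 * h * n - h + 1) * p
     - 2 * h + 4 * (h - n) * p ^ 2 + 1"

text \<open>\<open>F\<close> is the polynomial
  \<open>(1 - 2p - x)^((n-h)/p - 1) (1 - x)^(n - 2 - (n-h)/p) s(x)\<close>.
  For \<open>h = p = 1\<close> the second exponent is \<open>-1\<close> (the cubic is then divisible by \<open>1 - x\<close>),
  so the exponent is an integer and the identity is required away from \<open>x = 1\<close>;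
  this determines \<open>F\<close> uniquely. The division by \<open>p\<close> is exact for \<open>n = h + (k - 1) p\<close>.\<close>

definition is_seidel_F :: "nat \<Rightarrow> nat \<Rightarrow> nat \<Rightarrow> complex poly \<Rightarrow> bool" where
  "is_seidel_F h n p F \<longleftrightarrow>
     (\<forall>x. x \<noteq> 1 \<longrightarrow>
        poly F x =
          (1 - 2 * of_nat p - x) powi (int ((n - h) div p) - 1)
          * (1 - x) powi (int n - 2 - int ((n - h) div p))
          * cubic_factor (of_nat h) (of_nat n) (of_nat p) x)"

end

theory Submission
  imports Defs
begin

text \<open>Off the diagonal, an entry of \<open>S(G)\<close> depends only on the blocks (\<open>C\<close> or some \<open>P\<^sub>j\<close>) of its
  row and column, and \<open>S(G) - I\<close> extends this to the diagonal. Hence \<open>S(G) - x I = (1 - x) I + U W\<close>,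
  where \<open>U\<close> has one column per block, and \<open>det (I + U W) = det (I + W U)\<close> reduces the determinant to
  one of size \<open>k + 1\<close>. With \<open>y = 1 - x\<close> and \<open>z = y - 2 p\<close>, that matrix is
  \<open>diag (y, z, \<dots>, z)\<close> plus a matrix of rank 2, so the same identity reduces it to size 2. The
  divisions by \<open>y\<close> and \<open>z\<close> are harmless since polynomials agreeing at almost all points are
  equal.\<close>

section \<open>Determinants of low-rank perturbations\<close>

text \<open>The block matrix \<open>M\<close> with rows \<open>(D, -F)\<close> and
  \<open>(G, 1)\<close> is made triangular in two ways by right factors of determinant 1. Clearing
  the lower left block leaves \<open>D + F * G\<close>; clearing the upper right one, with
  \<open>H\<close> the product of the inverse of \<open>D\<close> and \<open>F\<close>, leaves
  \<open>D\<close> and \<open>G * H + 1\<close>.\<close>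

lemma det_diag_plus_product:
  fixes d :: "nat \<Rightarrow> 'a::field"
  assumes d: "\<And>i. i < n \<Longrightarrow> d i \<noteq> 0"
  shows "det (mat n n (\<lambda>(i, j). (if i = j then d i else 0) + (\<Sum>l<m. f i l * g l j))) =
    (\<Prod>i<n. d i) *
    det (mat m m (\<lambda>(l, r). (if l = r then 1 else 0) + (\<Sum>i<n. g l i * f i r / d i)))"
    (is "det ?A = _ * det ?B")
proof -
  define D where "D = mat n n (\<lambda>(i, j). if i = j then d i else 0)"
  define H where "H = mat n m (\<lambda>(i, l). f i l / d i)"
  define F where "F = mat n m (\<lambda>(i, l). f i l)"
  define G where "G = mat m n (\<lambda>(l, j). g l j)"
  note defs = D_def H_def F_def G_def
  have D: "D \<in> carrier_mat n n" and F: "F \<in> carrier_mat n m" and G: "G \<in> carrier_mat m n"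
    and H: "H \<in> carrier_mat n m"
    by (auto simp: defs)
  have A: "D + F * G = ?A"
    by (intro eq_matI) (auto simp: defs scalar_prod_def lessThan_atLeast0)
  have B: "G * H + 1\<^sub>m m = ?B"
    by (intro eq_matI) (auto simp: defs scalar_prod_def lessThan_atLeast0)
  have DH: "D * H = F"
    using d by (intro eq_matI) (auto simp: defs scalar_prod_def if_distrib[of "\<lambda>x. x * _"] if_distrib[of "\<lambda>x. x / _"] cong: if_cong)
  define M where "M = four_block_mat D (- F) G (1\<^sub>m m)"
  define L where "L = four_block_mat (1\<^sub>m n) (0\<^sub>m n m) (- G) (1\<^sub>m m)"
  define U where "U = four_block_mat (1\<^sub>m n) H (0\<^sub>m m n) (1\<^sub>m m)"
  have M: "M \<in> carrier_mat (n + m) (n + m)" and L: "L \<in> carrier_mat (n + m) (n + m)"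
    and U: "U \<in> carrier_mat (n + m) (n + m)"
    using D F G H by (auto simp: M_def L_def U_def)
  have "M * L = four_block_mat ?A (- F) (0\<^sub>m m n) (1\<^sub>m m)"
    unfolding M_def L_def using D F G
    by (subst mult_four_block_mat[of _ n n _ m _ m]) (auto simp: A)
  hence "det (M * L) = det ?A"
    using F by (simp add: det_four_block_mat_lower_left_zero[of _ n _ m])
  moreover have "M * U = four_block_mat D (0\<^sub>m n m) G ?B"
    unfolding M_def U_def using D F G H
    by (subst mult_four_block_mat[of _ n n _ m _ m]) (auto simp: DH B)
  hence "det (M * U) = det D * det ?B"
    using D G by (simp add: det_four_block_mat_upper_right_zero[of _ n _ m])
  moreover have "det L = 1"
    unfolding L_def using G by (subst det_four_block_mat_upper_right_zero[of _ n _ m]) auto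
  moreover have "det U = 1"
    unfolding U_def using H by (subst det_four_block_mat_lower_left_zero[of _ n _ m]) auto
  moreover have "det D = (\<Prod>i<n. d i)"
  proof -
    have "det D = prod_list (diag_mat D)"
      by (rule det_upper_triangular[OF _ D]) (auto simp: D_def upper_triangular_def)
    also have "diag_mat D = map d [0..<n]"
      by (auto simp: diag_mat_def D_def)
    finally show ?thesis
      by (simp add: prod.distinct_set_conv_list[symmetric] lessThan_atLeast0)
  qed
  ultimately show ?thesis
    using det_mult[OF M L] det_mult[OF M U] by simp
qed

lemma det_mat_2:
  "det (mat 2 2 f) = f (0, 0) * f (1, 1) - f (0, 1) * f (1, 0 :: nat)"
  for f :: "nat \<times> nat \<Rightarrow> 'a::comm_ring_1"
proof -
  have "det (mat 2 2 f) = (\<Sum>j<2. mat 2 2 f $$ (0,j) * cofactor (mat 2 2 f) 0 j)"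
    by (rule laplace_expansion_row) auto
  also have "\<dots> = f (0, 0) * f (1, 1) - f (0, 1) * f (1, 0)"
    by (simp add: numeral_2_eq_2 cofactor_def det_single mat_delete_def)
  finally show ?thesis .
qed

text \<open>The powers of \<open>y\<close> clear the denominators left by
  \<open>det_diag_plus_product\<close> with constant diagonal \<open>y\<close>. The block sizes
  arise because column \<open>r\<close> of the small matrix sums over all indices with label
  \<open>r\<close>.\<close>

lemma det_block_kernel:
  fixes B :: "nat \<Rightarrow> nat \<Rightarrow> 'a::field"
  assumes y: "y \<noteq> 0" and b: "\<And>i. i < n \<Longrightarrow> b i < m"
  shows "y ^ m * det (mat n n (\<lambda>(i, j). (if i = j then y else 0) + B (b i) (b j))) =
    y ^ n * det (mat m m (\<lambda>(l, r). (if l = r then y else 0) + B l r * of_nat (card {i. i < n \<and> b i = r})))"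
    (is "_ * det ?M = _ * det ?N")
proof -
  \<comment> \<open>\<open>f\<close> is the incidence matrix between indices and blocks, so the
    product of \<open>f\<close> and \<open>g\<close> has entries
    \<open>B (b i) (b j)\<close>.\<close>
  define f where "f i l = (if b i = l then 1 else 0 :: 'a)" for i l
  define g where "g l j = B l (b j)" for l j
  have "?M = mat n n (\<lambda>(i, j). (if i = j then y else 0) + (\<Sum>l<m. f i l * g l j))"
    using b by (intro eq_matI) (auto simp: f_def g_def if_distrib[of "\<lambda>x. x * _"] cong: if_cong)
  hence "det ?M = y ^ n *
      det (mat m m (\<lambda>(l, r). (if l = r then 1 else 0) + (\<Sum>i<n. g l i * f i r / y)))"
    using det_diag_plus_product[of n "\<lambda>_. y" f g m] y by simp
  moreover have "y \<cdot>\<^sub>m mat m m (\<lambda>(l, r). (if l = r then 1 else 0) + (\<Sum>i<n. g l i * f i r / y)) = ?N"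
  proof (intro eq_matI)
    fix l r assume lr: "l < dim_row ?N" "r < dim_col ?N"
    have "(\<Sum>i<n. g l i * f i r) = (\<Sum>i | i < n \<and> b i = r. B l r)"
      by (intro sum.mono_neutral_cong_right) (auto simp: f_def g_def)
    thus "(y \<cdot>\<^sub>m mat m m (\<lambda>(l, r). (if l = r then 1 else 0) + (\<Sum>i<n. g l i * f i r / y))) $$ (l, r)
        = ?N $$ (l, r)"
      using lr y by (auto simp: algebra_simps sum_distrib_left simp flip: sum_divide_distrib)
  qed auto
  hence "det ?N = y ^ m *
      det (mat m m (\<lambda>(l, r). (if l = r then 1 else 0) + (\<Sum>i<n. g l i * f i r / y)))"
    by (metis (no_types, lifting) det_smult dim_col_mat(1))
  ultimately show ?thesis by simp
qed

text \<open>Block 0 is the common clique \<open>C\<close>, block \<open>j > 0\<close> is \<open>P\<^sub>j\<close>; the values are the entries of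
  \<open>S(G) - I\<close>.\<close>

definition block_kernel :: "nat \<Rightarrow> nat \<Rightarrow> 'a::comm_ring_1" where
  "block_kernel l r = (if l = 0 \<or> r = 0 \<or> l = r then - 1 else 1)"

text \<open>Apart from row and column 0, the diagonal entry is \<open>y - p = z + p\<close> and all
  others are \<open>p\<close>. Taking \<open>z\<close> out of the diagonal therefore leaves equal
  rows, apart from row 0.\<close>

lemma det_quotient_matrix:
  fixes y c p :: "'a::field"
  assumes y: "y \<noteq> 0" and z: "z = y - 2 * p" "z \<noteq> 0" and k: "k \<ge> 1"
  shows "det (mat (Suc k) (Suc k) (\<lambda>(l, r). (if l = r then y else 0) +
      block_kernel l r * (if r = 0 then c else p))) =
    z ^ (k - 1) * (y * z - c * z + of_nat k * p * y - 2 * c * of_nat k * p)"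
    (is "det ?N = _")
proof -
  define d where "d i = (if i = 0 then y else z)" for i :: nat
  \<comment> \<open>The term \<open>l = 0\<close> puts the row \<open>(-c, p, ..., p)\<close>
    everywhere; the term \<open>l = 1\<close> corrects row 0 only, turning each \<open>p\<close>
    into \<open>-p\<close>.\<close>
  define f where "f i l = (if l = 0 \<or> i = 0 then 1 else 0 :: 'a)" for i l :: nat
  define g where "g l j = (if l = 0 then if j = 0 then - c else p
      else if j = 0 then 0 else - 2 * p)" for l j :: nat
  have "?N = mat (Suc k) (Suc k) (\<lambda>(i, j). (if i = j then d i else 0) + (\<Sum>l<2. f i l * g l j))"
    by (intro eq_matI)
      (auto simp: d_def f_def g_def block_kernel_def z(1) numeral_2_eq_2 algebra_simps)
  hence "det ?N = (\<Prod>i<Suc k. d i) * det (mat 2 2 (\<lambda>(l, r). (if l = r then 1 else 0) +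
      (\<Sum>i<Suc k. g l i * f i r / d i)))"
    using det_diag_plus_product[of "Suc k" d f g 2] y z(2) by (simp add: d_def)
  also have "(\<Prod>i<Suc k. d i) = y * z ^ k"
    by (simp only: prod.lessThan_Suc_shift) (simp add: d_def)
  also have "det (mat 2 2 (\<lambda>(l, r). (if l = r then 1 else 0) + (\<Sum>i<Suc k. g l i * f i r / d i))) =
      (1 - c / y + of_nat k * p / z) - (c / y) * (2 * p * of_nat k / z)"
    by (simp only: det_mat_2 sum.lessThan_Suc_shift) (simp add: d_def f_def g_def)
  also have "z ^ k = z * z ^ (k - 1)"
    using k by (cases k) auto
  also have "y * (z * z ^ (k - 1)) *
      ((1 - c / y + of_nat k * p / z) - (c / y) * (2 * p * of_nat k / z)) =
      z ^ (k - 1) * (y * z - c * z + of_nat k * p * y - 2 * c * of_nat k * p)"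
    using y z(2) by (simp add: field_simps)
  finally show ?thesis .
qed

section \<open>The characteristic polynomial of a matrix with block structure\<close>

lemma poly_eqI_cofinite:
  fixes P Q :: "'a::{idom,ring_char_0} poly"
  assumes "finite A" and "\<And>x. x \<notin> A \<Longrightarrow> poly P x = poly Q x"
  shows "P = Q"
proof (rule ccontr)
  assume "P \<noteq> Q"
  hence "finite {x. poly (P - Q) x = 0}"
    by (intro poly_roots_finite) simp
  moreover have "UNIV \<subseteq> A \<union> {x. poly (P - Q) x = 0}"
    using assms(2) by auto
  ultimately show False
    using assms(1) infinite_UNIV_char_0 finite_subset by blast
qed

text \<open>The reduction to size \<open>k + 1\<close> compares \<open>y ^ (k + 1)\<close> with
  \<open>y ^ n\<close>. Only \<open>y ^ k\<close> is cancelled, since \<open>n = k\<close> is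
  possible; hence the remaining factor \<open>Y\<close> on the left.\<close>

lemma char_poly_block_kernel:
  fixes S :: "'a::field_char_0 mat" and p c :: nat
  defines "Y \<equiv> [:1, - 1:]" and "Z \<equiv> [:1 - 2 * of_nat p, - 1:]"
  assumes k: "1 \<le> k" "k \<le> n"
    and b: "\<And>i. i < n \<Longrightarrow> b i \<le> k"
    and c: "card {i. i < n \<and> b i = 0} = c"
    and p: "\<And>r. 1 \<le> r \<Longrightarrow> r \<le> k \<Longrightarrow> card {i. i < n \<and> b i = r} = p"
    and S: "S = mat n n (\<lambda>(i, j). (if i = j then 1 else 0) + block_kernel (b i) (b j))"
  shows "Y * Polynomial.smult ((- 1) ^ n) (char_poly S) =
    Y ^ (n - k) * (Z ^ (k - 1) *
      (Y * Z - Polynomial.smult (of_nat c) Z + Polynomial.smult (of_nat (k * p)) Y - [:of_nat (2 * c * k * p):]))"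
proof (rule poly_eqI_cofinite[of "{1, 1 - 2 * of_nat p}"])
  fix x :: 'a assume x: "x \<notin> {1, 1 - 2 * of_nat p}"
  define y z where "y = 1 - x" and "z = y - 2 * of_nat p"
  have y: "y \<noteq> 0" and z: "z \<noteq> 0"
    using x by (auto simp: y_def z_def algebra_simps)
  have YZ: "poly Y x = y" "poly Z x = z"
    by (simp_all add: Y_def Z_def y_def z_def)
  have carrier: "S \<in> carrier_mat n n"
    by (simp add: S)
  have "char_matrix S x = mat n n (\<lambda>(i, j). (if i = j then y else 0) + block_kernel (b i) (b j))"
    unfolding char_matrix_def S y_def by (intro eq_matI) auto
  \<comment> \<open>\<open>char_poly\<close> is the determinant of \<open>x I - S\<close>, while the
    reduction treats \<open>S - x I\<close>; this gives the sign \<open>(- 1) ^ n\<close>.\<close>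
  moreover have "- char_matrix S x = (- 1) \<cdot>\<^sub>m char_matrix S x"
    by (intro eq_matI) auto
  hence "poly (char_poly S) x = (- 1) ^ n * det (char_matrix S x)"
    using carrier_matD[OF char_matrix_closed[OF carrier, of x]]
    by (simp add: char_poly_matrix[OF carrier])
  ultimately have "y ^ Suc k * ((- 1) ^ n * poly (char_poly S) x) =
      y ^ Suc k * det (mat n n (\<lambda>(i, j). (if i = j then y else 0) + block_kernel (b i) (b j)))"
    by simp
  also have "\<dots> = y ^ n * det (mat (Suc k) (Suc k) (\<lambda>(l, r). (if l = r then y else 0) +
      block_kernel l r * of_nat (card {i. i < n \<and> b i = r})))"
    using b by (intro det_block_kernel y) (simp add: less_Suc_eq_le)
  also have "mat (Suc k) (Suc k) (\<lambda>(l, r). (if l = r then y else 0) +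
      block_kernel l r * of_nat (card {i. i < n \<and> b i = r})) =
    mat (Suc k) (Suc k) (\<lambda>(l, r). (if l = r then y else 0) +
      block_kernel l r * (if r = 0 then of_nat c else of_nat p))"
    using c p by (intro eq_matI) auto
  also have "det \<dots> = z ^ (k - 1) *
      (y * z - of_nat c * z + of_nat k * of_nat p * y - 2 * of_nat c * of_nat k * of_nat p)"
    by (rule det_quotient_matrix[OF y z_def z k(1)])
  also have "y ^ n = y ^ k * y ^ (n - k)"
    using k by (simp flip: power_add)
  finally have "y * ((- 1) ^ n * poly (char_poly S) x) = y ^ (n - k) * (z ^ (k - 1) *
      (y * z - of_nat c * z + of_nat k * of_nat p * y - 2 * of_nat c * of_nat k * of_nat p))"
    using y by (simp add: mult.assoc)
  thus "poly (Y * Polynomial.smult ((- 1) ^ n) (char_poly S)) x =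
    poly (Y ^ (n - k) * (Z ^ (k - 1) *
      (Y * Z - Polynomial.smult (of_nat c) Z + Polynomial.smult (of_nat (k * p)) Y - [:of_nat (2 * c * k * p):]))) x"
    by (simp add: YZ mult.left_commute)
qed simp

lemma card_nth_Collect:
  assumes "distinct vs"
  shows "card {i. i < length vs \<and> Q (vs ! i)} = card {v \<in> set vs. Q v}"
proof -
  have "bij_betw ((!) vs) {i. i < length vs \<and> Q (vs ! i)} {v \<in> set vs. Q v}"
    using assms by (auto simp: bij_betw_def inj_on_def nth_eq_iff_index_eq in_set_conv_nth)
  thus ?thesis
    by (rule bij_betw_same_card)
qed

text \<open>The bracket is the quadratic of \<open>det_quotient_matrix\<close> for
  \<open>c = h - p\<close>. Thus \<open>1 - 2 * p\<close> is a root of the cubic, which explains why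
  the exponent in the polynomial F is \<open>k - 2\<close> although the determinant has
  \<open>z ^ (k - 1)\<close>.\<close>

lemma cubic_factor_eq:
  assumes "n = h + (k - 1) * p"
  shows "cubic_factor h n p x = (1 - 2 * p - x) *
    ((1 - x) * (1 - 2 * p - x) - (h - p) * (1 - 2 * p - x) + k * p * (1 - x) - 2 * (h - p) * k * p)"
  unfolding cubic_factor_def assms 
  by (simp add: algebra_simps power2_eq_square power3_eq_cube)

theorem theorem2:
  fixes h p k n :: nat
    and V C :: "'v set" and P :: "nat \<Rightarrow> 'v set" and E :: "'v set set" and vs :: "'v list"
    and S :: "complex mat"
  assumes "1 \<le> p" and "p \<le> h" and "2 \<le> k"
    and "n = h + (k - 1) * p"
    and "simple_graph V E"
    and "V = C \<union> (\<Union>j\<in>{1..k}. P j)"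
    and "\<forall>j\<in>{1..k}. C \<inter> P j = {}"
    and "\<forall>i\<in>{1..k}. \<forall>j\<in>{1..k}. i \<noteq> j \<longrightarrow> P i \<inter> P j = {}"
    and "card C = h - p"
    and "\<forall>j\<in>{1..k}. card (P j) = p"
    and "\<forall>j\<in>{1..k}. is_clique E (C \<union> P j)"
    and "\<forall>i\<in>{1..k}. \<forall>j\<in>{1..k}. i \<noteq> j \<longrightarrow> (\<forall>u\<in>P i. \<forall>v\<in>P j. {u, v} \<notin> E)"
    and "distinct vs" and "set vs = V"
    and "S = seidel_matrix vs E"
  shows "(\<exists>F. is_seidel_F h n p F \<and> eigenvalue_mset S = proots F)
    \<and> count (eigenvalue_mset S) 1 \<ge> n - h - (n - h) div p
    \<and> count (eigenvalue_mset S) (1 - 2 * of_nat p) \<ge> (n - h) div p - 1"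
  proof -

  \<comment> \<open>Block labels and adjacency in the graph\<close>
  note p1 = assms(1) and ph = assms(2) and k2 = assms(3) and n = assms(4) and graph = assms(5)
    and V = assms(6) and CP = assms(7) and PP = assms(8) and cardC = assms(9) and cardP = assms(10)
    and clique = assms(11) and nonadj = assms(12) and dist = assms(13) and vs = assms(14)
    and S = assms(15)
  \<comment> \<open>Labels follow the convention of \<open>block_kernel\<close>; disjointness of the
    sets \<open>P j\<close> makes the description unique.\<close>
  define b where "b v = (if v \<in> C then 0 else (THE j. j \<in> {1..k} \<and> v \<in> P j))" for v
  have bP: "b v = j" if "j \<in> {1..k}" "v \<in> P j" for v j
  proof -
    have "v \<notin> C" using that CP by blast
    moreover have "(THE j. j \<in> {1..k} \<and> v \<in> P j) = j"
      using that PP by (intro the_equality) blast+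
    ultimately show ?thesis by (simp add: b_def)
  qed
  have bC: "b v = 0" if "v \<in> C" for v
    using that by (simp add: b_def)
  have blocks: "v \<in> C \<or> (\<exists>j\<in>{1..k}. v \<in> P j)" if "v \<in> V" for v
    using that V by blast
  have b_le: "b v \<le> k" if "v \<in> V" for v
    using blocks[OF that] bC bP by force
  have block0: "{v \<in> V. b v = 0} = C"
    using blocks bP bC V by fastforce
  have blockj: "{v \<in> V. b v = j} = P j" if "j \<in> {1..k}" for j
  proof (intro subset_antisym subsetI)
    fix v assume "v \<in> {v \<in> V. b v = j}"
    hence v: "v \<in> V" "b v = j" by auto
    hence "v \<notin> C" using bC that by force
    then obtain i where "i \<in> {1..k}" "v \<in> P i" using blocks v by blast
    thus "v \<in> P j" using bP v by blast
  next
    fix v assume "v \<in> P j"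
    thus "v \<in> {v \<in> V. b v = j}" using bP V that by blast
  qed
  have finV: "finite V"
    using graph by (simp add: simple_graph_def)

  have len: "length vs = n"
  proof -
    have "length vs = card V"
      using dist vs by (metis distinct_card)
    also have "\<dots> = card C + card (\<Union>j\<in>{1..k}. P j)"
      unfolding V using finV CP by (intro card_Un_disjoint) (auto simp: V)
    also have "card (\<Union>j\<in>{1..k}. P j) = k * p"
      using finV PP cardP by (subst card_UN_disjoint) (auto simp: V)
    finally show ?thesis
      using cardC ph k2 n by (cases k) auto
  qed
  have kn: "k \<le> n"
  proof -
    have "(k - 1) * 1 \<le> (k - 1) * p" using p1 by (intro mult_le_mono) auto
    thus ?thesis using n p1 ph k2 by linarith
  qed

  have adj: "{u, v} \<in> E \<longleftrightarrow> u \<noteq> v \<and> (b u = 0 \<or> b v = 0 \<or> b u = b v)"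
    if "u \<in> V" "v \<in> V" for u v
  proof -
    have no_loop: "{u, v} \<notin> E" if "u = v"
      using graph that by (auto simp: simple_graph_def)
    have edge: "{u, v} \<in> E" if "j \<in> {1..k}" "u \<in> C \<union> P j" "v \<in> C \<union> P j" "u \<noteq> v" for j
      using clique that by (auto simp: is_clique_def)
    consider "u \<in> C" "v \<in> C" | j where "j \<in> {1..k}" "u \<in> C" "v \<in> P j"
      | i where "i \<in> {1..k}" "u \<in> P i" "v \<in> C"
      | i j where "i \<in> {1..k}" "j \<in> {1..k}" "u \<in> P i" "v \<in> P j"
      using blocks[of u] blocks[of v] \<open>u \<in> V\<close> \<open>v \<in> V\<close> by blast
    thus ?thesis
    proof cases
      case 1
      \<comment> \<open>Every one of the cliques contains \<open>C\<close>, so the first one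
        serves.\<close>
      thus ?thesis using edge[of 1] no_loop bC k2 by auto
    next
      case 2
      thus ?thesis using edge[of j] no_loop bC by auto
    next
      case 3
      thus ?thesis using edge[of i] no_loop bC by auto
    next
      case 4
      hence "b u = i" "b v = j" using bP by auto
      thus ?thesis using 4 edge[of i] no_loop nonadj by (cases "i = j") auto
    qed
  qed

  \<comment> \<open>The Seidel matrix in block form\<close>
  define c where "c i = b (vs ! i)" for i
  have nthV: "vs ! i \<in> V" if "i < n" for i
    using that len vs nth_mem by blast
  have S': "S = mat n n (\<lambda>(i, j). (if i = j then 1 else 0) + block_kernel (c i) (c j))"
  proof (intro eq_matI)
    fix i j assume "i < dim_row (mat n n (\<lambda>(i, j). (if i = j then 1 else 0) + block_kernel (c i) (c j)) :: complex mat)"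
      "j < dim_col (mat n n (\<lambda>(i, j). (if i = j then 1 else 0) + block_kernel (c i) (c j)) :: complex mat)"
    hence ij: "i < n" "j < n" by auto
    have "vs ! i = vs ! j \<longleftrightarrow> i = j"
      using dist ij len by (simp add: nth_eq_iff_index_eq)
    \<comment> \<open>Off the diagonal, \<open>1 - 2 A\<close> is -1 on edges and 1 elsewhere; on
      the diagonal, 0 is \<open>1 + (- 1)\<close>.\<close>
    thus "S $$ (i, j) = mat n n (\<lambda>(i, j). (if i = j then 1 else 0) + block_kernel (c i) (c j)) $$ (i, j)"
      using ij adj[OF nthV nthV, OF ij]
      by (auto simp: S seidel_matrix_def all_ones_matrix_def adjacency_matrix_def len
          block_kernel_def c_def)
  qed (auto simp: S seidel_matrix_def adjacency_matrix_def len)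

  \<comment> \<open>The polynomial F and the multiplicities of its roots\<close>
  define Y Z where "Y = [:1, - 1 :: complex:]" and "Z = [:1 - 2 * of_nat p, - 1 :: complex:]"
  define Q where "Q = Y * Z - Polynomial.smult (of_nat (h - p)) Z + Polynomial.smult (of_nat (k * p)) Y
    - [:of_nat (2 * (h - p) * k * p):]"
  \<comment> \<open>The sign makes \<open>F\<close> the determinant of \<open>S - x I\<close> and
    does not affect the roots.\<close>
  define F where "F = Polynomial.smult ((- 1) ^ n) (char_poly S)"
  have YF: "Y * F = Y ^ (n - k) * (Z ^ (k - 1) * Q)"
    unfolding F_def Q_def Y_def Z_def
  proof (rule char_poly_block_kernel[OF _ kn _ _ _ S'])
    show "c i \<le> k" if "i < n" for i
      using b_le nthV that by (simp add: c_def)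
    show "card {i. i < n \<and> c i = 0} = h - p"
      using card_nth_Collect[OF dist, of "\<lambda>v. b v = 0"] by (simp add: c_def len vs block0 cardC)
    show "card {i. i < n \<and> c i = r} = p" if "1 \<le> r" "r \<le> k" for r
      using card_nth_Collect[OF dist, of "\<lambda>v. b v = r"] that cardP
      by (simp add: c_def len vs blockj)
  qed (use k2 in simp)

  have "S \<in> carrier_mat n n"
    by (simp add: S')
  hence "char_poly S \<noteq> 0"
    using degree_monic_char_poly[of S n] by auto
  hence F0: "F \<noteq> 0" and eig: "eigenvalue_mset S = proots F"
    by (simp_all add: F_def eigenvalue_mset_def)
  have "Y \<noteq> 0" by (simp add: Y_def)
  hence YF0: "Y * F \<noteq> 0" using F0 by (rule no_zero_divisors)
  have quot: "(n - h) div p = k - 1"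
    using n p1 by simp

  have "is_seidel_F h n p F"
    unfolding is_seidel_F_def quot
  proof (intro allI impI)
    fix x :: complex assume "x \<noteq> 1"
    define y z where "y = 1 - x" and "z = 1 - 2 * of_nat p - x"
    have y: "y \<noteq> 0" using \<open>x \<noteq> 1\<close> by (simp add: y_def)
    have YZ: "poly Y x = y" "poly Z x = z"
      by (simp_all add: Y_def Z_def y_def z_def)
    have "y * poly F x = y ^ (n - k) * (z ^ (k - 1) * poly Q x)"
      using arg_cong[OF YF, of "\<lambda>q. poly q x"] by (simp add: YZ)
    \<comment> \<open>One factor \<open>z\<close> is split off to complete the quadratic
      \<open>Q\<close> to the cubic.\<close>
    also have "z ^ (k - 1) = z ^ (k - 2) * z"
      using k2 by (metis Suc_diff_le diff_Suc_Suc numeral_2_eq_2 power_Suc2 One_nat_def)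
    also have "z ^ (k - 2) * z * poly Q x = z ^ (k - 2) * (z * poly Q x)"
      by simp
    also have "z * poly Q x = cubic_factor (of_nat h) (of_nat n) (of_nat p) x"
      using k2 ph
      by (subst cubic_factor_eq[of _ _ "of_nat k"])
        (simp_all add: n of_nat_diff Q_def YZ flip: y_def z_def)
    finally have "poly F x = z ^ (k - 2) * (y ^ (n - k) / y) *
        cubic_factor (of_nat h) (of_nat n) (of_nat p) x"
      using y by (simp add: field_simps)
    moreover have "z powi (int (k - 1) - 1) = z ^ (k - 2)"
    proof -
      have "int (k - 1) - 1 = int (k - 2)" using k2 by simp
      thus ?thesis by (simp only: power_int_of_nat)
    qed
    \<comment> \<open>The exponent is \<open>n - k - 1\<close>, which is -1 when
      \<open>h = p = 1\<close>, so a division by \<open>y\<close> is kept.\<close>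
    moreover have "y powi (int n - 2 - int (k - 1)) = y ^ (n - k) / y"
    proof -
      have "int n - 2 - int (k - 1) = int (n - k) - 1" using k2 kn by simp
      thus ?thesis
        by (simp only: power_int_diff[OF disjI1[OF y]] power_int_of_nat power_int_1_right)
    qed
    ultimately show "poly F x = (1 - 2 * of_nat p - x) powi (int (k - 1) - 1) *
        (1 - x) powi (int n - 2 - int (k - 1)) * cubic_factor (of_nat h) (of_nat n) (of_nat p) x"
      by (simp add: y_def z_def)
  qed
  moreover have "n - h - (k - 1) \<le> order 1 F"
  \<comment> \<open>If \<open>h = 1\<close>, then \<open>p = 1\<close> and \<open>n = k\<close>, so
    the bound is 0. Otherwise \<open>h\<close> is at least 2, and the bound follows from
    \<open>n - k - 1\<close>: of the \<open>n - k\<close> factors dividing \<open>Y * F\<close>, one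
    belongs to \<open>Y\<close>.\<close>
  proof (cases "h = 1")
    case True
    thus ?thesis using n p1 ph by simp
  next
    case False
    hence "n - h - (k - 1) \<le> n - k - 1"
      using p1 ph k2 by simp
    also have "\<dots> \<le> order 1 F"
    proof -
      have Y': "Y = Polynomial.smult (- 1) [:- 1, 1:]" by (simp add: Y_def)
      have "[:- 1, 1:] ^ (n - k) dvd Y ^ (n - k)"
        unfolding Y' smult_power by (simp add: dvd_smult)
      hence "[:- 1, 1:] ^ (n - k) dvd Y * F"
        unfolding YF by (rule dvd_mult2)
      hence "n - k \<le> order 1 (Y * F)"
        using YF0 order_divides by blast
      also have "\<dots> = order 1 Y + order 1 F"
        using YF0 by (rule order_mult)
      also have "order 1 Y = 1"
        unfolding Y' using order_power_n_n[of 1 1] by (subst order_smult) auto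
      finally show ?thesis by simp
    qed
    finally show ?thesis .
  qed
  moreover have "k - 1 \<le> order (1 - 2 * of_nat p) F"
  proof -
    let ?a = "1 - 2 * of_nat p :: complex"
    have Z': "Z = Polynomial.smult (- 1) [:- ?a, 1:]" by (simp add: Z_def)
    have "[:- ?a, 1:] ^ (k - 1) dvd Z ^ (k - 1)"
      unfolding Z' smult_power by (simp add: dvd_smult)
    hence "[:- ?a, 1:] ^ (k - 1) dvd Y * F"
      unfolding YF by (intro dvd_mult dvd_mult2)
    hence "k - 1 \<le> order ?a (Y * F)"
      using YF0 order_divides by blast
    also have "\<dots> = order ?a Y + order ?a F"
      using YF0 by (rule order_mult)
    \<comment> \<open>As \<open>p\<close> is positive, \<open>1 - 2 * p\<close> differs from 1, the
      only root of \<open>Y\<close>, so the whole factor \<open>Z ^ (k - 1)\<close> counts for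
      \<open>F\<close>.\<close>
    also have "order ?a Y = 0"
      using p1 by (intro order_0I) (simp add: Y_def)
    finally show ?thesis by simp
  qed
  ultimately show ?thesis
    unfolding eig quot using F0 by auto
qed

end
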